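(* Assume that: (i) for every $i\in\{1,\dots,N\}$ the function $f_i:\mathbb{R}^d\to\mathbb{R}$ is differentiable and strongly convex with coefficient $\alpha>0$; (ii) for every $i$ the gradient $\nabla f_i$ is Lipschitz continuous with constant $\beta>0$; (iii) the graph $\mathcal{G}$ is undirected and connected. Let $x^\star\in\mathbb{R}^d$ be the unique minimizer of $\sum_{i=1}^N f_i$. For $\Delta>0$, consider the Synchronous Triggered Gradient Tracking algorithm with communication period $\Delta$: with $t^k = k\Delta$, $k=0,1,2,\dots$, for all $k\ge0$, all $t\in[t^k,t^{k+1})$ and all $i\in\{1,\dots,N\}$, $$\dot x_i(t) = -\sum_{j\in\mathcal{N}_i} w_{ij}\big(x_i(t^k)-x_j(t^k)\big) - z_i(t)-\nabla f_i(x_i(t)),$$ $$\dot z_i(t) = -\sum_{j\in\mathcal{N}_i} w_{ij}\big(z_i(t^k)-z_j(t^k)\big) - \sum_{j\in\mathcal{N}_i} w_{ij}\big(\nabla f_i(x_i(t^k))-\nabla f_j(x_j(t^k))\big),$$ with $x_i,z_i$ continuous on $[0,\infty)$. Pick any initial condition $x(0)=\mathrm{col}(x_1(0),\dots,x_N(0))\in\mathbb{R}^{Nd}$, $z(0)=\mathrm{col}(z_1(0),\dots,z_N(0))\in\mathbb{R}^{Nd}$ such that $\sum_{i=1}^N z_i(0)=0$. Then there exist $\Delta^\star>0$, $a_3>0$ and $a_4>0$ such that for any $\Delta\in(0,\Delta^\star)$ it holds $$\|x_i(t)-x^\star\|\le a_3\exp(-a_4 t)\qquad\text{for all } t\ge0\text{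 and all } i\in\{1,\dots,N\}.$$
   Context: $N$ agents communicate over a graph $\mathcal{G}=(\{1,\dots,N\},\mathcal{E})$. The set of neighbors of agent $i$ is $\mathcal{N}_i=\{j : (i,j)\in\mathcal{E}\}$, which includes $i$ itself (self-loops). $\mathcal{W}=[w_{ij}]\in\mathbb{R}^{N\times N}$ is a symmetric weighted adjacency matrix with $w_{ij}>0$ if $(i,j)\in\mathcal{E}$ and $w_{ij}=0$ otherwise. $\mathrm{col}$ denotes vertical concatenation and $\|\cdot\|$ the Euclidean norm. *)

theory Defs
  imports "HOL-Analysis.Analysis"
begin

definition strongly_convex :: "real \<Rightarrow> ('a::real_normed_vector \<Rightarrow> real) \<Rightarrow> bool" where
  "strongly_convex \<alpha> f \<longleftrightarrow>
     (\<forall>x y. \<forall>s\<in>{0..1}.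
        f (s *\<^sub>R x + (1 - s) *\<^sub>R y)
          \<le> s * f x + (1 - s) * f y - \<alpha> / 2 * s * (1 - s) * (norm (x - y))\<^sup>2)"

text \<open>Meaningful only at points where the function is differentiable.\<close>
definition grad :: "('a::euclidean_space \<Rightarrow> real) \<Rightarrow> 'a \<Rightarrow> 'a" where
  "grad f x = (THE D. GDERIV f x :> D)"

text \<open>A graph on the vertex type is its edge relation; \<open>refl E\<close> provides the self-loops, so that
  \<open>i \<in> neighbors E i\<close>.\<close>

definition neighbors :: "('n \<times> 'n) set \<Rightarrow> 'n \<Rightarrow> 'n set" where
  "neighbors E i = {j. (i, j) \<in> E}"

definition connected_graph :: "('n \<times> 'n) set \<Rightarrow> bool" where
  "connected_graph E \<longleftrightarrow> (\<forall>i j. (i, j) \<in> E\<^sup>*)"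

definition weighted_adjacency :: "('n::finite \<times> 'n) set \<Rightarrow> real^'n^'n \<Rightarrow> bool" where
  "weighted_adjacency E W \<longleftrightarrow>
     transpose W = W \<and>
     (\<forall>i j. ((i, j) \<in> E \<longrightarrow> W $ i $ j > 0) \<and> ((i, j) \<notin> E \<longrightarrow> W $ i $ j = 0))"

text \<open>Trajectories of the Synchronous Triggered Gradient Tracking algorithm with communication
  period \<open>\<Delta>\<close>. The stacked state \<open>x t\<close> has the block \<open>x t $ i\<close> for agent \<open>i\<close>. The derivative is
  taken within the half-open sampling interval: it is the usual two-sided derivative at interior
  points and the right derivative at the sampling time \<open>k\<Delta>\<close>, where the right-hand side jumps.\<close>

definition STGT_solution ::
  "('n::finite \<times> 'n) set \<Rightarrow> real^'n^'n \<Rightarrow> ('n \<Rightarrow> real^'d \<Rightarrow> real) \<Rightarrow> real \<Rightarrow>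
   (real \<Rightarrow> (real^'d)^'n) \<Rightarrow> (real \<Rightarrow> (real^'d)^'n) \<Rightarrow> bool" where
  "STGT_solution E W f \<Delta> x z \<longleftrightarrow>
     continuous_on {0..} x \<and> continuous_on {0..} z \<and>
     (\<forall>(k::nat) i. \<forall>t \<in> {real k * \<Delta> ..< real (Suc k) * \<Delta>}.
        ((\<lambda>s. x s $ i) has_vector_derivative
            (- (\<Sum>j\<in>neighbors E i. (W $ i $ j) *\<^sub>R (x (real k * \<Delta>) $ i - x (real k * \<Delta>) $ j))
             - z t $ i - grad (f i) (x t $ i)))
          (at t within {real k * \<Delta> ..< real (Suc k) * \<Delta>}) \<and>
        ((\<lambda>s. z s $ i) has_vector_derivative
            (- (\<Sum>j\<in>neighbors E i. (W $ i $ j) *\<^sub>R (z (real k * \<Delta>) $ i - z (real k * \<Delta>) $ j))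
             - (\<Sum>j\<in>neighbors E i. (W $ i $ j) *\<^sub>R
                  (grad (f i) (x (real k * \<Delta>) $ i) - grad (f j) (x (real k * \<Delta>) $ j)))))
          (at t within {real k * \<Delta> ..< real (Suc k) * \<Delta>}))"

end

theory Submission
  imports Defs
begin

text \<open>
  Write \<open>e = x - x\<^sup>\<star>\<close>, \<open>y = z + \<nabla>f(x\<^sup>\<star>)\<close>, \<open>g e = \<nabla>f(x\<^sup>\<star> + e) - \<nabla>f(x\<^sup>\<star>)\<close> for the stacked errors, and let \<open>L\<close>
  be the graph Laplacian. The zero-sum initial condition keeps \<open>y\<close> in the range of \<open>L\<close>, so
  \<open>y = L p\<close> with \<open>p\<close> in the range of \<open>L\<close>; put \<open>q = p - P e\<close>, where \<open>P\<close> is the projection onto that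
  range. Without sampling the dynamics become the primal-dual flow \<open>e' = - 2 L e - L q - g e\<close>,
  \<open>q' = L e\<close>, for which \<open>|e|\<^sup>2 + |q|\<^sup>2 + 2 \<epsilon> \<langle>e, L q\<rangle>\<close> with small \<open>\<epsilon>\<close> is a strict quadratic Lyapunov
  function. Sampling perturbs the vector field by \<open>O(|X(t) - X(t\<^sup>k)|) = O(\<Delta> |X(t)|)\<close> for \<open>X = (e, q)\<close>,
  which the decay rate absorbs once \<open>\<Delta>\<close> is small.
\<close>

section \<open>Sampled systems with a quadratic Lyapunov function\<close>

text \<open>The vector field jumps at the sampling times, so a derivative is available only strictly
  between them. Continuity extends monotonicity to each closed sampling interval, and induction over
  the grid joins the intervals.\<close>

lemma sampled_nonincreasing:
  fixes h :: "real \<Rightarrow> real"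
  assumes "\<Delta> > 0" and cont: "continuous_on {0..} h"
    and deriv: "\<And>(k::nat) t. real k * \<Delta> < t \<Longrightarrow> t < real (Suc k) * \<Delta> \<Longrightarrow>
                  \<exists>D\<le>0. (h has_real_derivative D) (at t)"
    and "t \<ge> 0"
  shows "h t \<le> h 0"
proof -
  have step: "h s \<le> h (real k * \<Delta>)"
    if s: "real k * \<Delta> \<le> s" "s \<le> real (Suc k) * \<Delta>" for k s
  proof (rule DERIV_nonpos_imp_decreasing_open[OF s(1)])
    show "continuous_on {real k * \<Delta>..s} h"
      by (rule continuous_on_subset[OF cont]) (use \<open>\<Delta> > 0\<close> in \<open>auto intro: order_trans[rotated]\<close>)
    fix u assume "real k * \<Delta> < u" "u < s"
    then show "\<exists>y. DERIV h u :> y \<and> y \<le> 0"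
      using deriv[of k u] s by auto
  qed
  have grid: "h (real k * \<Delta>) \<le> h 0" for k
  proof (induction k)
    case (Suc k)
    have "h (real (Suc k) * \<Delta>) \<le> h (real k * \<Delta>)"
      using \<open>\<Delta> > 0\<close> by (intro step) (auto simp: algebra_simps)
    with Suc show ?case by simp
  qed simp
  define k where "k = nat \<lfloor>t / \<Delta>\<rfloor>"
  have "real k \<le> t / \<Delta>" "t / \<Delta> \<le> real (Suc k)"
    using assms(1,4) by (auto simp: k_def) linarith+
  then have "real k * \<Delta> \<le> t" "t \<le> real (Suc k) * \<Delta>"
    using \<open>\<Delta> > 0\<close> by (auto simp: field_simps)
  from step[OF this] grid[of k] show ?thesis by linarith
qed

text \<open>The deviation since the last sample is measured against the current norm |X t|, because
  the Lyapunov estimate is made at the current time. The mean value inequality bounds it through the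
  maximum of |X| on the interval; on a short interval that maximum is at most 2 |X a|, and |X a| is
  at most 2 |X t|.\<close>

lemma sampling_error_bound:
  fixes X :: "real \<Rightarrow> 'a::real_inner"
  assumes "a < b" "K > 0" and small: "8 * K * (b - a) \<le> 1"
    and cont: "continuous_on {a..b} X"
    and deriv: "\<And>s. a < s \<Longrightarrow> s < b \<Longrightarrow> (X has_vector_derivative D s) (at s)"
    and bound: "\<And>s. a < s \<Longrightarrow> s < b \<Longrightarrow> norm (D s) \<le> K * (norm (X s) + norm (X a))"
    and t: "t \<in> {a..b}"
  shows "norm (X t - X a) \<le> 8 * K * (b - a) * norm (X t)"
proof -
  have "continuous_on {a..b} (\<lambda>s. norm (X s))"
    using cont by (intro continuous_intros)
  then obtain \<tau> where \<tau>: "\<tau> \<in> {a..b}" "\<And>s. s \<in> {a..b} \<Longrightarrow> norm (X s) \<le> norm (X \<tau>)"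
    using continuous_attains_sup[of "{a..b}" "\<lambda>s. norm (X s)"] \<open>a < b\<close> by auto
  define m where "m = norm (X \<tau>)"
  have m: "norm (X s) \<le> m" if "s \<in> {a..b}" for s
    using \<tau> that by (simp add: m_def)
  have dev: "norm (X s - X a) \<le> 2 * K * (b - a) * m" if s: "s \<in> {a..b}" for s
  proof (cases "s = a")
    case True
    then show ?thesis using \<open>a < b\<close> \<open>K > 0\<close> m[of a] by (simp add: m_def)
  next
    case False
    then have "a < s" using s by simp
    have "\<exists>u\<in>{a<..<s}. norm (X s - X a) \<le> norm ((s - a) *\<^sub>R D u)"
      using mvt_general[of a s X "\<lambda>u h. h *\<^sub>R D u"] \<open>a < s\<close> s deriv
        continuous_on_subset[OF cont, of "{a..s}"]
      by (auto simp: has_vector_derivative_def)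
    then obtain u where u: "a < u" "u < s" "norm (X s - X a) \<le> (s - a) * norm (D u)"
      using \<open>a < s\<close> by auto
    have "norm (D u) \<le> K * (norm (X u) + norm (X a))"
      using bound[of u] u s by auto
    also have "\<dots> \<le> K * (m + m)"
      using u s \<open>K > 0\<close> \<open>a < b\<close> by (intro mult_left_mono add_mono m) auto
    finally have "(s - a) * norm (D u) \<le> (b - a) * (K * (m + m))"
      using s by (intro mult_mono) auto
    with u(3) show ?thesis by (simp add: algebra_simps)
  qed
  have m0: "m \<ge> 0" by (simp add: m_def)
  \<comment> \<open>The length condition yields m \<le> |X a| + m/4, so the bound on the maximum
    closes on itself without Gronwall's inequality.\<close>
  have "2 * K * (b - a) * m \<le> 1/4 * m"
    using small m0 by (intro mult_right_mono) auto
  moreover have "m - norm (X a) \<le> 2 * K * (b - a) * m"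
    using dev[OF \<tau>(1)] norm_triangle_ineq2[of "X \<tau>" "X a"] unfolding m_def by linarith
  ultimately have m2: "m \<le> 2 * norm (X a)"
    using m0 norm_ge_zero[of "X a"] by linarith
  have "2 * K * (b - a) * m \<le> 2 * K * (b - a) * (2 * norm (X a))"
    using m2 \<open>a < b\<close> \<open>K > 0\<close> by (intro mult_left_mono) auto
  with dev[OF t] have d: "norm (X t - X a) \<le> 4 * K * (b - a) * norm (X a)"
    by (simp only: mult.assoc mult.commute mult.left_commute)
  also have "\<dots> \<le> 1/2 * norm (X a)"
    using small by (intro mult_right_mono) auto
  finally have "norm (X a) \<le> 2 * norm (X t)"
    using norm_triangle_ineq2[of "X a" "X t"] by (simp add: norm_minus_commute)
  then have "4 * K * (b - a) * norm (X a) \<le> 4 * K * (b - a) * (2 * norm (X t))"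
    using \<open>a < b\<close> \<open>K > 0\<close> by (intro mult_left_mono) auto
  with d show ?thesis by simp
qed

text \<open>In \<open>F v w\<close> the argument \<open>v\<close> is the current state and
  \<open>w\<close> the last sample. Decrease is assumed only for the unsampled field
  \<open>F v v\<close>; along a trajectory the difference \<open>F v w - F v v\<close> is
  O(\<Delta>) |v| by the sampling error bound, so for small \<Delta> the form
  \<open>v \<bullet> S v\<close> still decays. The set \<open>U\<close> carries a linear or other
  constraint obeyed by the trajectories.\<close>

theorem sampled_lyapunov_decay:
  fixes F :: "'a::real_inner \<Rightarrow> 'a \<Rightarrow> 'a" and S :: "'a \<Rightarrow> 'a"
  assumes S: "bounded_linear S" and sym: "\<And>v w. S v \<bullet> w = v \<bullet> S w"
    and "\<sigma> > 0" and upper: "\<And>v. norm (S v) \<le> \<sigma> * norm v"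
    and "\<mu> > 0" and lower: "\<And>v. \<mu> * (norm v)\<^sup>2 \<le> v \<bullet> S v"
    and "K > 0" and growth: "\<And>v w. norm (F v w) \<le> K * (norm v + norm w)"
    and lip: "\<And>v w. norm (F v w - F v v) \<le> K * norm (v - w)"
    and "c > 0" and decr: "\<forall>v\<in>U. S v \<bullet> F v v \<le> - c * (norm v)\<^sup>2"
  shows "\<exists>\<Delta>star>0. \<exists>C>0. \<exists>a>0. \<forall>\<Delta>\<in>{0<..<\<Delta>star}. \<forall>X.
           continuous_on {0..} X \<and> (\<forall>t\<ge>0. X t \<in> U) \<and>
           (\<forall>(k::nat) t. real k * \<Delta> < t \<and> t < real (Suc k) * \<Delta> \<longrightarrow>
              (X has_vector_derivative F (X t) (X (real k * \<Delta>))) (at t)) \<longrightarrow>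
           (\<forall>t\<ge>0. norm (X t) \<le> C * norm (X 0) * exp (- a * t))"
proof -
  \<comment> \<open>The first bound is the length condition of \<open>sampling_error_bound\<close>;
    the second lets the sampling term consume at most half of the decrease \<open>c\<close>. The
    remaining half gives the rate \<open>2 * a = c / \<sigma>\<close> for the quadratic form, and
    \<open>C\<close> is the square root of the ratio of its upper and lower bounds.\<close>
  define \<Delta>star where "\<Delta>star = min (1 / (8 * K)) (c / (16 * \<sigma> * K\<^sup>2))"
  define a where "a = c / (2 * \<sigma>)"
  define C where "C = sqrt (\<sigma> / \<mu>)"
  have pos: "\<Delta>star > 0" "C > 0" "a > 0"
    using \<open>K > 0\<close> \<open>c > 0\<close> \<open>\<sigma> > 0\<close> \<open>\<mu> > 0\<close> by (auto simp: \<Delta>star_def C_def a_def)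
  have V_upper: "v \<bullet> S v \<le> \<sigma> * (norm v)\<^sup>2" for v
  proof -
    have "v \<bullet> S v \<le> norm v * norm (S v)" by (rule norm_cauchy_schwarz)
    also have "\<dots> \<le> norm v * (\<sigma> * norm v)" by (intro mult_left_mono upper) auto
    finally show ?thesis by (simp add: power2_eq_square algebra_simps)
  qed
  have main: "\<forall>\<Delta>\<in>{0<..<\<Delta>star}. \<forall>X.
           continuous_on {0..} X \<and> (\<forall>t\<ge>0. X t \<in> U) \<and>
           (\<forall>(k::nat) t. real k * \<Delta> < t \<and> t < real (Suc k) * \<Delta> \<longrightarrow>
              (X has_vector_derivative F (X t) (X (real k * \<Delta>))) (at t)) \<longrightarrow>
           (\<forall>t\<ge>0. norm (X t) \<le> C * norm (X 0) * exp (- a * t))"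
  proof (intro ballI allI impI, elim conjE)
    fix \<Delta> X and t :: real
    assume \<Delta>_in: "\<Delta> \<in> {0<..<\<Delta>star}" and cont: "continuous_on {0..} X"
      and U': "\<forall>t\<ge>0. X t \<in> U"
      and ode': "\<forall>(k::nat) t. real k * \<Delta> < t \<and> t < real (Suc k) * \<Delta> \<longrightarrow>
              (X has_vector_derivative F (X t) (X (real k * \<Delta>))) (at t)"
      and "t \<ge> 0"
    have \<Delta>: "0 < \<Delta>" "\<Delta> < \<Delta>star" using \<Delta>_in by auto
    have U: "\<And>t. t \<ge> 0 \<Longrightarrow> X t \<in> U"
      and ode: "\<And>(k::nat) t. real k * \<Delta> < t \<Longrightarrow> t < real (Suc k) * \<Delta> \<Longrightarrow>
              (X has_vector_derivative F (X t) (X (real k * \<Delta>))) (at t)"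
      using U' ode' by blast+
    have \<Delta>1: "8 * K * \<Delta> \<le> 1" and \<Delta>2: "16 * \<sigma> * K\<^sup>2 * \<Delta> \<le> c"
      using \<Delta> \<open>K > 0\<close> \<open>c > 0\<close> \<open>\<sigma> > 0\<close> by (auto simp: \<Delta>star_def field_simps)
    \<comment> \<open>Decay of the quadratic form at rate \<open>2 * a\<close> is monotonicity of
      this weighted form, to which \<open>sampled_nonincreasing\<close> applies.\<close>
    define h where "h s = (X s \<bullet> S (X s)) * exp (2 * a * s)" for s
    have "h t \<le> h 0"
    proof (rule sampled_nonincreasing[OF \<Delta>(1) _ _ \<open>t \<ge> 0\<close>])
      show "continuous_on {0..} h"
        unfolding h_def
        by (intro continuous_intros cont bounded_linear.continuous_on[OF S])
      fix k :: nat and s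
      assume s: "real k * \<Delta> < s" "s < real (Suc k) * \<Delta>"
      define w where "w = X (real k * \<Delta>)"
      have k0: "0 \<le> real k * \<Delta>" using \<Delta> by simp
      have err: "norm (X s - w) \<le> 8 * K * \<Delta> * norm (X s)"
      proof -
        have len: "real (Suc k) * \<Delta> - real k * \<Delta> = \<Delta>" by (simp add: algebra_simps)
        have contk: "continuous_on {real k * \<Delta>..real (Suc k) * \<Delta>} X"
          using k0 by (intro continuous_on_subset[OF cont]) auto
        have "norm (X s - X (real k * \<Delta>)) \<le>
          8 * K * (real (Suc k) * \<Delta> - real k * \<Delta>) * norm (X s)"
          by (rule sampling_error_bound[where D = "\<lambda>s. F (X s) w"])
             (use s \<open>K > 0\<close> \<Delta>1 ode growth contk len in
               \<open>auto simp: w_def simp del: of_nat_Suc\<close>)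
        then show ?thesis by (simp only: len w_def)
      qed
      have dX: "(X has_vector_derivative F (X s) w) (at s)"
        using ode[OF s] by (simp add: w_def)
      have dS: "((\<lambda>s. S (X s)) has_vector_derivative S (F (X s) w)) (at s)"
        by (rule bounded_linear.has_vector_derivative[OF S dX])
      have dV: "((\<lambda>s. X s \<bullet> S (X s)) has_real_derivative 2 * (S (X s) \<bullet> F (X s) w)) (at s)"
        using bounded_bilinear.has_vector_derivative[OF bounded_bilinear_inner dX dS]
          sym[of "X s" "F (X s) w"]
        by (simp add: has_real_derivative_iff_has_vector_derivative inner_commute[of "F (X s) w"])
      have dh: "(h has_real_derivative
           2 * (S (X s) \<bullet> F (X s) w) * exp (2 * a * s) +
           (2 * a * exp (2 * a * s)) * (X s \<bullet> S (X s))) (at s)"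
        unfolding h_def by (rule DERIV_mult[OF dV]) (auto intro!: derivative_eq_intros)
      have "S (X s) \<bullet> F (X s) w = S (X s) \<bullet> F (X s) (X s) + S (X s) \<bullet> (F (X s) w - F (X s) (X s))"
        by (simp add: inner_diff_right)
      also have "\<dots> \<le> - c * (norm (X s))\<^sup>2 + norm (S (X s)) * norm (F (X s) w - F (X s) (X s))"
        using s k0 by (intro add_mono decr[rule_format] U norm_cauchy_schwarz) auto
      also have "norm (S (X s)) * norm (F (X s) w - F (X s) (X s)) \<le>
          (\<sigma> * norm (X s)) * (K * (8 * K * \<Delta> * norm (X s)))"
        using \<open>K > 0\<close> \<open>\<sigma> > 0\<close> \<Delta>
        by (intro mult_mono upper order_trans[OF lip] err mult_left_mono) auto
      also have "\<dots> = (8 * \<sigma> * K\<^sup>2 * \<Delta>) * (norm (X s))\<^sup>2"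
        by (simp add: power2_eq_square)
      also have "\<dots> \<le> (c / 2) * (norm (X s))\<^sup>2"
        using \<Delta>2 by (intro mult_right_mono) auto
      finally have "2 * (S (X s) \<bullet> F (X s) w) \<le> - (2 * a) * (\<sigma> * (norm (X s))\<^sup>2)"
        using \<open>\<sigma> > 0\<close> by (simp add: a_def)
      also have "\<dots> \<le> - (2 * a) * (X s \<bullet> S (X s))"
        using V_upper[of "X s"] pos by simp
      finally have "2 * (S (X s) \<bullet> F (X s) w) + 2 * a * (X s \<bullet> S (X s)) \<le> 0" by simp
      then have "(2 * (S (X s) \<bullet> F (X s) w) + 2 * a * (X s \<bullet> S (X s))) * exp (2 * a * s) \<le> 0"
        by (intro mult_nonpos_nonneg) auto
      with dh show "\<exists>D\<le>0. (h has_real_derivative D) (at s)"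
        by (intro exI conjI) (auto simp: algebra_simps)
    qed
    then have ht: "(X t \<bullet> S (X t)) * exp (2 * a * t) \<le> \<sigma> * (norm (X 0))\<^sup>2"
      using V_upper[of "X 0"] by (simp add: h_def)
    have "\<mu> * (norm (X t))\<^sup>2 * exp (2 * a * t) \<le> \<sigma> * (norm (X 0))\<^sup>2"
      by (rule order_trans[OF mult_right_mono[OF lower] ht]) simp
    then have "(norm (X t) * exp (a * t))\<^sup>2 \<le> (C * norm (X 0))\<^sup>2"
      using \<open>\<mu> > 0\<close> \<open>\<sigma> > 0\<close>
      by (simp add: C_def power_mult_distrib field_simps exp_double[symmetric])
    then have "norm (X t) * exp (a * t) \<le> C * norm (X 0)"
      by (rule power2_le_imp_le) (use pos in simp)
    then show "norm (X t) \<le> C * norm (X 0) * exp (- a * t)" by (simp add: exp_minus field_simps)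
  qed
  show ?thesis
    by (rule exI[of _ \<Delta>star], rule conjI[OF pos(1)], rule exI[of _ C], rule conjI[OF pos(2)],
        rule exI[of _ a], rule conjI[OF pos(3) main])
qed

section \<open>The tracking dynamics for an abstract Laplacian\<close>

text \<open>If L (L v) = 0 then |L v| = 0 by selfadjointness, so \<open>L\<close> is injective on
  its range and, by dimension, maps it onto itself. Injectivity provides a left inverse there, and
  surjectivity makes it two-sided on the range.\<close>

lemma selfadjoint_left_inverse_on_range:
  fixes L :: "'a::euclidean_space \<Rightarrow> 'a"
  assumes L: "linear L" and sa: "\<And>v w. L v \<bullet> w = v \<bullet> L w"
  obtains N where "linear N" "range N \<subseteq> range L" "\<And>v. N (L (L v)) = L v" "\<And>v. L (N (L v)) = L v"
proof -
  have zero: "L v = 0" if "L (L v) = 0" for v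
    using sa[of "L v" v] that by simp
  have inj: "inj_on L (range L)"
  proof (rule inj_onI)
    fix u v assume "u \<in> range L" "v \<in> range L" and eq: "L u = L v"
    then obtain a b where ab: "u = L a" "v = L b" by blast
    then have "L (L (a - b)) = 0" using eq by (simp add: linear_diff[OF L])
    then show "u = v" using zero[of "a - b"] ab by (simp add: linear_diff[OF L])
  qed
  have sub: "subspace (range L)"
    by (simp add: L linear_subspace_image)
  have "L ` range L = range L"
  proof (rule subspace_dim_equal)
    show "dim (L ` range L) \<ge> dim (range L)"
      using dim_image_eq[OF L, of "range L"] inj sub by (simp add: span_eq_iff[THEN iffD2])
  qed (use sub L in \<open>auto intro: linear_subspace_image\<close>)
  obtain N where N: "range N \<subseteq> range L" "linear N" "\<forall>v\<in>range L. N (L v) = v"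
    using linear_exists_left_inverse_on[OF L sub inj] by blast
  have "L (N (L v)) = L v" for v
  proof -
    obtain u where "L v = L (L u)"
      using \<open>L ` range L = range L\<close> by blast
    then show ?thesis using N(3) by simp
  qed
  with N show thesis by (intro that) auto
qed

text \<open>The shift by \<open>P e\<close> in the coordinate q = N y - P e makes the gradient terms
  of \<open>y\<close> and \<open>e\<close> cancel up to a difference between current and sampled
  values. The system then has the form required by \<open>sampled_lyapunov_decay\<close>, with
  \<open>U\<close> expressing that q lies in the range of \<open>L\<close>.\<close>

theorem tracking_decay:
  fixes L :: "'a::euclidean_space \<Rightarrow> 'a" and g :: "'a \<Rightarrow> 'a"
  assumes L: "linear L" and sa: "\<And>v w. L v \<bullet> w = v \<bullet> L w" and psd: "\<And>v. v \<bullet> L v \<ge> 0"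
    and "\<alpha> > 0" and g_mono: "\<And>v. v \<bullet> g v \<ge> \<alpha> * (norm v)\<^sup>2"
    and "\<beta> > 0" and g_lip: "\<And>v w. norm (g v - g w) \<le> \<beta> * norm (v - w)" and g0: "g 0 = 0"
  shows "\<exists>\<Delta>star>0. \<exists>C>0. \<exists>a>0. \<forall>\<Delta>\<in>{0<..<\<Delta>star}. \<forall>e y.
           continuous_on {0..} e \<and> continuous_on {0..} y \<and> y 0 \<in> range L \<and>
           (\<forall>(k::nat) t. real k * \<Delta> < t \<and> t < real (Suc k) * \<Delta> \<longrightarrow>
              (e has_vector_derivative - L (e (real k * \<Delta>)) - y t - g (e t)) (at t) \<and>
              (y has_vector_derivative - L (y (real k * \<Delta>) + g (e (real k * \<Delta>)))) (at t)) \<longrightarrow>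
           (\<forall>t\<ge>0. norm (e t) \<le> C * (norm (e 0) + norm (y 0)) * exp (- a * t))"
proof -
  obtain N where N: "linear N" "range N \<subseteq> range L" "\<And>v. N (L (L v)) = L v" "\<And>v. L (N (L v)) = L v"
    by (rule selfadjoint_left_inverse_on_range[OF L sa]) blast
  \<comment> \<open>the orthogonal projection onto the range of \<open>L\<close>\<close>
  define P where "P v = N (L v)" for v
  have P: "linear P"
    unfolding P_def by (rule linear_compose[OF L N(1), unfolded o_def])
  have bL: "bounded_linear L" and bN: "bounded_linear N" and bP: "bounded_linear P"
    using L N(1) P by (simp_all add: linear_conv_bounded_linear)
  obtain l where l: "l > 0" "\<And>v. norm (L v) \<le> l * norm v"
    using bounded_linear.pos_bounded[OF bL] by (auto simp: mult.commute)
  obtain \<nu> where \<nu>: "\<nu> > 0" "\<And>v. norm (N v) \<le> \<nu> * norm v"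
    using bounded_linear.pos_bounded[OF bN] by (auto simp: mult.commute)
  obtain \<pi> where \<pi>: "\<pi> > 0" "\<And>v. norm (P v) \<le> \<pi> * norm v"
    using bounded_linear.pos_bounded[OF bP] by (auto simp: mult.commute)
  note Lsimps = linear_add[OF L] linear_diff[OF L] linear_neg[OF L] linear_0[OF L]
  note Nsimps = linear_add[OF N(1)] linear_diff[OF N(1)] linear_neg[OF N(1)] linear_0[OF N(1)]
  note Psimps = linear_add[OF P] linear_diff[OF P] linear_neg[OF P] linear_0[OF P]
  have LP: "L (P v) = L v" for v by (simp add: P_def N(4))
  have PL: "P (L v) = L v" for v by (simp add: P_def N(3))
  have g_bound: "norm (g v) \<le> \<beta> * norm v" for v
    using g_lip[of v 0] g0 by simp

  \<comment> \<open>Differentiating the cross term of the Lyapunov function leaves positive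
    contributions in |a|, for a the first component: Young's inequality on the mixed terms gives the
    first summand of \<open>\<gamma>\<close>, and |L a| squared gives the second. The first bound on
    \<open>\<epsilon>\<close> keeps the form positive definite, the second spends at most half of
    \<open>\<alpha>\<close> on these contributions.\<close>
  define \<gamma> where "\<gamma> = (2 * l + \<beta>)\<^sup>2 / 2 + l\<^sup>2"
  have \<gamma>: "\<gamma> > 0" using l(1) \<open>\<beta> > 0\<close> by (simp add: \<gamma>_def add_pos_pos)
  define \<epsilon> where "\<epsilon> = min (1 / (2 * l)) (\<alpha> / (2 * \<gamma>))"
  have \<epsilon>: "\<epsilon> > 0" "\<epsilon> * l \<le> 1 / 2" "\<epsilon> * \<gamma> \<le> \<alpha> / 2"
    using l(1) \<gamma> \<open>\<alpha> > 0\<close> by (auto simp: \<epsilon>_def min_def field_simps)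
  \<comment> \<open>The plain sum of squares decreases only through \<open>e\<close>, because the
    couplings of e and q cancel. The cross term adds a negative multiple of |L q| squared.\<close>
  define S where "S v = (fst v + \<epsilon> *\<^sub>R L (snd v), snd v + \<epsilon> *\<^sub>R L (fst v))" for v :: "'a \<times> 'a"
  \<comment> \<open>For \<open>w = v\<close> the second component reduces to
    \<open>L (fst v)\<close>, the dual equation of the primal-dual flow.\<close>
  define F where "F v w =
      (- L (fst w) - L (fst v) - L (snd v) - g (fst v),
       L (fst v) + L (snd v - snd w) + P (g (fst v) - g (fst w)))" for v w :: "'a \<times> 'a"
  define U where "U = (UNIV :: 'a set) \<times> range L"
  define \<sigma> where "\<sigma> = 1 + \<epsilon> * l"
  \<comment> \<open>On the range of \<open>L\<close> one has |q| \<le> \<nu> |L q|, which converts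
    the decrease in |L q| into decrease in |q| and explains the factor with \<open>\<nu>\<close>.
    The constant \<open>K\<close> below is chosen large enough for both the growth and the Lipschitz
    bound of \<open>F\<close>.\<close>
  define c where "c = min (\<alpha> / 2) (\<epsilon> / (2 * \<nu>\<^sup>2))"
  define K where "K = 4 * l + \<beta> + \<pi> * \<beta>"
  have pos: "\<sigma> > 0" "c > 0" "K > 0"
    using l(1) \<nu>(1) \<pi>(1) \<epsilon>(1) \<open>\<alpha> > 0\<close> \<open>\<beta> > 0\<close> by (auto simp: \<sigma>_def c_def K_def add_pos_pos)
  have norm_prod: "(norm v)\<^sup>2 = (norm (fst v))\<^sup>2 + (norm (snd v))\<^sup>2" for v :: "'a \<times> 'a"
    by (cases v) (simp add: norm_Pair)
  have fs: "norm (fst v) \<le> norm v" "norm (snd v) \<le> norm v" for v :: "'a \<times> 'a"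
    by (cases v; simp add: norm_fst_le norm_snd_le)+

  \<comment> \<open>Symmetry and two-sided bounds of the quadratic form\<close>
  have "linear S"
    by (rule linearI) (auto simp: S_def Lsimps linear_scale[OF L] algebra_simps)
  then have S: "bounded_linear S" by (simp add: linear_conv_bounded_linear)
  have S_sym: "S v \<bullet> w = v \<bullet> S w" for v w
    by (simp add: S_def inner_prod_def inner_add_left inner_add_right sa)
  have S_upper: "norm (S v) \<le> \<sigma> * norm v" for v
  proof -
    have "S v = v + \<epsilon> *\<^sub>R (L (snd v), L (fst v))" by (cases v) (simp add: S_def)
    then have "norm (S v) \<le> norm v + \<epsilon> * norm (L (snd v), L (fst v))"
      using norm_triangle_ineq[of v "\<epsilon> *\<^sub>R (L (snd v), L (fst v))"] \<epsilon>(1) by (simp del: scaleR_Pair)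
    also have "norm (L (snd v), L (fst v)) \<le> l * norm v"
    proof (rule power2_le_imp_le)
      have "(norm (L (snd v), L (fst v)))\<^sup>2 \<le> (l * norm (snd v))\<^sup>2 + (l * norm (fst v))\<^sup>2"
        unfolding norm_prod by (intro add_mono power_mono) (simp_all add: l)
      also have "\<dots> = (l * norm v)\<^sup>2"
        by (simp add: power_mult_distrib norm_prod algebra_simps)
      finally show "(norm (L (snd v), L (fst v)))\<^sup>2 \<le> (l * norm v)\<^sup>2" .
    qed (use l in simp)
    finally show ?thesis using \<epsilon>(1) by (simp add: \<sigma>_def algebra_simps)
  qed
  have S_lower: "1 / 2 * (norm v)\<^sup>2 \<le> v \<bullet> S v" for v
  proof -
    obtain a b where v: "v = (a, b)" by (cases v)
    have "\<bar>a \<bullet> L b\<bar> \<le> norm a * norm (L b)" by (rule Cauchy_Schwarz_ineq2)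
    also have "\<dots> \<le> norm a * (l * norm b)" by (intro mult_left_mono l) simp
    finally have "\<epsilon> * \<bar>a \<bullet> L b\<bar> \<le> \<epsilon> * l * (norm a * norm b)"
      using \<epsilon>(1) by (simp add: ac_simps)
    also have "\<dots> \<le> 1 / 2 * (norm a * norm b)" using \<epsilon>(2) by (intro mult_right_mono) auto
    finally have "2 * (\<epsilon> * \<bar>a \<bullet> L b\<bar>) \<le> norm a * norm b" by simp
    also have "\<dots> \<le> ((norm a)\<^sup>2 + (norm b)\<^sup>2) / 2"
      using sum_squares_bound[of "norm a" "norm b"] by simp
    finally have *: "2 * (\<epsilon> * \<bar>a \<bullet> L b\<bar>) \<le> ((norm a)\<^sup>2 + (norm b)\<^sup>2) / 2" .
    have "v \<bullet> S v = (norm a)\<^sup>2 + (norm b)\<^sup>2 + 2 * (\<epsilon> * (a \<bullet> L b))"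
      by (simp add: v S_def inner_add_right power2_norm_eq_inner inner_commute[of b "L a"] sa[of a b])
    moreover have "- (\<epsilon> * \<bar>a \<bullet> L b\<bar>) \<le> \<epsilon> * (a \<bullet> L b)"
      using \<epsilon>(1) by (metis abs_ge_minus_self abs_mult abs_of_pos minus_le_iff)
    ultimately show ?thesis using * by (simp add: v norm_prod)
  qed

  \<comment> \<open>Growth of the field and its dependence on the sample\<close>
  have growth: "norm (F v w) \<le> K * (norm v + norm w)" for v w
  proof -
    have "norm (P (g (fst v) - g (fst w))) \<le> \<pi> * (\<beta> * norm (fst v - fst w))"
      using \<pi>(1) by (intro order_trans[OF \<pi>(2)] mult_left_mono g_lip) simp
    also have "\<dots> \<le> \<pi> * \<beta> * (norm v + norm w)"
      using \<pi>(1) \<open>\<beta> > 0\<close> norm_triangle_ineq4[of "fst v" "fst w"] fs[of v] fs[of w] by simp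
    finally have 1: "norm (P (g (fst v) - g (fst w))) \<le> \<pi> * \<beta> * (norm v + norm w)" .
    have 2: "norm (L (fst u)) \<le> l * norm u" "norm (L (snd u)) \<le> l * norm u" 
      "norm (g (fst u)) \<le> \<beta> * norm u" for u :: "'a \<times> 'a"
      using l(1) \<open>\<beta> > 0\<close> fs[of u]
      by (auto intro!: order_trans[OF l(2)] order_trans[OF g_bound])
    have "norm (F v w) \<le> norm (fst (F v w)) + norm (snd (F v w))"
      using norm_Pair_le[of "fst (F v w)" "snd (F v w)"] by simp
    also have "norm (fst (F v w)) \<le> norm (L (fst w)) + norm (L (fst v)) + norm (L (snd v)) + norm (g (fst v))"
      unfolding F_def fst_conv
      by (smt (verit) norm_triangle_ineq4 norm_minus_cancel)
    also have "norm (snd (F v w)) \<le> norm (L (fst v)) + (norm (L (snd v)) + norm (L (snd w))) + norm (P (g (fst v) - g (fst w)))"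
      unfolding F_def snd_conv Lsimps
      by (smt (verit) norm_triangle_ineq4 norm_triangle_ineq)
    finally have "norm (F v w) \<le> 4 * (l * norm v) + 2 * (l * norm w) + \<beta> * norm v + \<pi> * \<beta> * (norm v + norm w)"
      using 1 2[of v] 2[of w] by linarith
    also have "\<dots> \<le> K * (norm v + norm w)"
      using l(1) \<open>\<beta> > 0\<close> by (simp add: K_def algebra_simps)
    finally show ?thesis .
  qed
  have lip: "norm (F v w - F v v) \<le> K * norm (v - w)" for v w
  proof -
    have "F v w - F v v = (L (fst (v - w)), L (snd (v - w)) + P (g (fst v) - g (fst w)))"
      by (simp add: F_def Lsimps Psimps)
    then have "norm (F v w - F v v) \<le>
        norm (L (fst (v - w))) + norm (L (snd (v - w)) + P (g (fst v) - g (fst w)))"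
      using norm_Pair_le by metis
    also have "\<dots> \<le> norm (L (fst (v - w))) + (norm (L (snd (v - w))) + norm (P (g (fst v) - g (fst w))))"
      by (intro add_left_mono norm_triangle_ineq)
    also have "\<dots> \<le> l * norm (v - w) + (l * norm (v - w) + \<pi> * (\<beta> * norm (v - w)))"
      using l(1) \<pi>(1) \<open>\<beta> > 0\<close> fs[of "v - w"]
      by (intro add_mono order_trans[OF l(2)] order_trans[OF \<pi>(2)] mult_left_mono
           order_trans[OF g_lip]) auto
    also have "\<dots> \<le> K * norm (v - w)"
      using l(1) \<open>\<beta> > 0\<close> by (simp add: K_def algebra_simps)
    finally show ?thesis .
  qed

  \<comment> \<open>Strict decrease along the unsampled field\<close>
  have decr: "\<forall>v\<in>U. S v \<bullet> F v v \<le> - c * (norm v)\<^sup>2"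
  proof
    fix v assume vU: "v \<in> U"
    obtain a b u where v: "v = (a, b)" "b = L u"
      using vU by (cases v) (auto simp: U_def)
    define p where "p = L b"
    \<comment> \<open>Since \<open>b\<close> lies in the range of \<open>L\<close>, applying
      \<open>N\<close> to \<open>p\<close> recovers \<open>b\<close>. This is where membership in
      \<open>U\<close> enters.\<close>
    have "norm b \<le> \<nu> * norm p" using \<nu>(2)[of p] N(3)[of u] by (simp add: p_def v(2))
    then have "(norm b)\<^sup>2 \<le> \<nu>\<^sup>2 * (norm p)\<^sup>2"
      by (metis norm_ge_zero power_mono power_mult_distrib)
    then have bp: "\<epsilon> / (2 * \<nu>\<^sup>2) * (norm b)\<^sup>2 \<le> \<epsilon> / 2 * (norm p)\<^sup>2"
      using \<epsilon>(1) \<nu>(1) by (simp add: field_simps)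
    \<comment> \<open>The products of \<open>a\<close> with \<open>L b\<close> and of
      \<open>b\<close> with \<open>L a\<close> cancel by selfadjointness; the negative square of |p|
      comes from the cross term.\<close>
    have eq: "S v \<bullet> F v v = - 2 * (a \<bullet> L a) - a \<bullet> g a
        + \<epsilon> * (- 2 * (p \<bullet> L a) - (norm p)\<^sup>2 - p \<bullet> g a + (norm (L a))\<^sup>2)"
      by (simp add: v(1) S_def F_def p_def[symmetric] Lsimps Psimps inner_add_left inner_add_right
          inner_diff_right sa[of a b] power2_norm_eq_inner inner_commute[of b "L a"] algebra_simps)
    have "- 2 * (p \<bullet> L a) - p \<bullet> g a \<le> (2 * l + \<beta>) * norm a * norm p"
    proof -
      have "- 2 * (p \<bullet> L a) - p \<bullet> g a = p \<bullet> (- (2 *\<^sub>R L a) - g a)"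
        by (simp add: inner_diff_right)
      also have "\<dots> \<le> norm p * norm (- (2 *\<^sub>R L a) - g a)" by (rule norm_cauchy_schwarz)
      also have "\<dots> \<le> norm p * (2 * norm (L a) + norm (g a))"
        by (intro mult_left_mono order_trans[OF norm_triangle_ineq4]) auto
      also have "\<dots> \<le> norm p * (2 * (l * norm a) + \<beta> * norm a)"
        by (intro mult_left_mono add_mono l g_bound) auto
      finally show ?thesis by (simp add: algebra_simps)
    qed
    moreover have "(2 * l + \<beta>) * norm a * norm p \<le> ((2 * l + \<beta>)\<^sup>2 * (norm a)\<^sup>2 + (norm p)\<^sup>2) / 2"
      using sum_squares_bound[of "(2 * l + \<beta>) * norm a" "norm p"]
      by (simp add: power_mult_distrib)
    moreover have "(norm (L a))\<^sup>2 \<le> l\<^sup>2 * (norm a)\<^sup>2"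
      using l(2)[of a] by (metis norm_ge_zero power_mono power_mult_distrib)
    moreover have "\<gamma> * (norm a)\<^sup>2 = (2 * l + \<beta>)\<^sup>2 * (norm a)\<^sup>2 / 2 + l\<^sup>2 * (norm a)\<^sup>2"
      by (simp add: \<gamma>_def distrib_right)
    ultimately have "- 2 * (p \<bullet> L a) - (norm p)\<^sup>2 - p \<bullet> g a + (norm (L a))\<^sup>2
        \<le> \<gamma> * (norm a)\<^sup>2 - (norm p)\<^sup>2 / 2"
      by argo
    then have "S v \<bullet> F v v \<le> - 2 * (a \<bullet> L a) - a \<bullet> g a
        + \<epsilon> * (\<gamma> * (norm a)\<^sup>2 - (norm p)\<^sup>2 / 2)"
      unfolding eq using \<epsilon>(1) by (intro add_left_mono mult_left_mono) auto
    also have "\<dots> \<le> - \<alpha> * (norm a)\<^sup>2 + (\<epsilon> * \<gamma>) * (norm a)\<^sup>2 - \<epsilon> / 2 * (norm p)\<^sup>2"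
      using psd[of a] g_mono[of a] by (simp add: algebra_simps)
    also have "\<dots> \<le> - \<alpha> * (norm a)\<^sup>2 + (\<alpha> / 2) * (norm a)\<^sup>2 - \<epsilon> / (2 * \<nu>\<^sup>2) * (norm b)\<^sup>2"
      using bp mult_right_mono[OF \<epsilon>(3), of "(norm a)\<^sup>2"] by simp
    also have "\<dots> = - ((\<alpha> / 2) * (norm a)\<^sup>2 + \<epsilon> / (2 * \<nu>\<^sup>2) * (norm b)\<^sup>2)"
      by simp
    also have "\<dots> \<le> - (c * (norm a)\<^sup>2 + c * (norm b)\<^sup>2)"
      unfolding neg_le_iff_le by (intro add_mono mult_right_mono) (auto simp: c_def)
    finally show "S v \<bullet> F v v \<le> - c * (norm v)\<^sup>2" by (simp add: v(1) norm_prod algebra_simps)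
  qed

  \<comment> \<open>Transfer of the decay to the original variables\<close>
  have half: "(0::real) < 1 / 2" by simp
  obtain \<Delta>star C a where decay: "\<Delta>star > 0" "C > 0" "a > 0" and
    decays: "\<forall>\<Delta>\<in>{0<..<\<Delta>star}. \<forall>X.
       continuous_on {0..} X \<and> (\<forall>t\<ge>0. X t \<in> U) \<and>
       (\<forall>(k::nat) t. real k * \<Delta> < t \<and> t < real (Suc k) * \<Delta> \<longrightarrow>
          (X has_vector_derivative F (X t) (X (real k * \<Delta>))) (at t)) \<longrightarrow>
       (\<forall>t\<ge>0. norm (X t) \<le> C * norm (X 0) * exp (- a * t))"
    using sampled_lyapunov_decay[OF S S_sym pos(1) S_upper half S_lower pos(3) growth lip pos(2) decr]
    by (elim exE conjE) assumption
  define C' where "C' = C * (1 + \<nu> + \<pi>)"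
  have "C' > 0" using decay(2) \<nu>(1) \<pi>(1) by (simp add: C'_def)
  have main: "\<forall>\<Delta>\<in>{0<..<\<Delta>star}. \<forall>e y.
           continuous_on {0..} e \<and> continuous_on {0..} y \<and> y 0 \<in> range L \<and>
           (\<forall>(k::nat) t. real k * \<Delta> < t \<and> t < real (Suc k) * \<Delta> \<longrightarrow>
              (e has_vector_derivative - L (e (real k * \<Delta>)) - y t - g (e t)) (at t) \<and>
              (y has_vector_derivative - L (y (real k * \<Delta>) + g (e (real k * \<Delta>)))) (at t)) \<longrightarrow>
           (\<forall>t\<ge>0. norm (e t) \<le> C' * (norm (e 0) + norm (y 0)) * exp (- a * t))"
  proof (intro ballI allI impI, elim conjE)
    fix \<Delta> e y and t :: real
    assume \<Delta>_in: "\<Delta> \<in> {0<..<\<Delta>star}" and ce: "continuous_on {0..} e" and cy: "continuous_on {0..} y"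
      and y0: "y 0 \<in> range L"
      and ode: "\<forall>(k::nat) t. real k * \<Delta> < t \<and> t < real (Suc k) * \<Delta> \<longrightarrow>
              (e has_vector_derivative - L (e (real k * \<Delta>)) - y t - g (e t)) (at t) \<and>
              (y has_vector_derivative - L (y (real k * \<Delta>) + g (e (real k * \<Delta>)))) (at t)"
      and "t \<ge> 0"
    have \<Delta>: "0 < \<Delta>" "\<Delta> < \<Delta>star" using \<Delta>_in by auto
    have de: "\<And>(k::nat) t. real k * \<Delta> < t \<Longrightarrow> t < real (Suc k) * \<Delta> \<Longrightarrow>
         (e has_vector_derivative - L (e (real k * \<Delta>)) - y t - g (e t)) (at t)"
      and dy: "\<And>(k::nat) t. real k * \<Delta> < t \<Longrightarrow> t < real (Suc k) * \<Delta> \<Longrightarrow>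
         (y has_vector_derivative - L (y (real k * \<Delta>) + g (e (real k * \<Delta>)))) (at t)"
      using ode by blast+
    define r where "r s = y s - L (N (y s))" for s
    \<comment> \<open>\<open>r\<close> is the component of \<open>y\<close> outside the range of \<open>L\<close>; it has zero derivative\<close>
    have LNy: "L (N (y s)) = y s" if "s \<ge> 0" for s
    proof -
      \<comment> \<open>The squared norm turns constancy of a vector into a statement about a
        nonnegative scalar: it starts at zero and cannot increase.\<close>
      have "r s \<bullet> r s \<le> r 0 \<bullet> r 0"
      proof (rule sampled_nonincreasing[OF \<Delta>(1) _ _ that])
        show "continuous_on {0..} (\<lambda>s. r s \<bullet> r s)"
          unfolding r_def
          by (intro continuous_intros cy bounded_linear.continuous_on[OF bL] bounded_linear.continuous_on[OF bN])
        fix k :: nat and u assume u: "real k * \<Delta> < u" "u < real (Suc k) * \<Delta>"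
        define d where "d = y (real k * \<Delta>) + g (e (real k * \<Delta>))"
        have dyu: "(y has_vector_derivative - L d) (at u)" using dy[OF u] by (simp add: d_def)
        have "(r has_vector_derivative - L d - L (N (- L d))) (at u)"
          unfolding r_def
          by (intro has_vector_derivative_diff dyu bounded_linear.has_vector_derivative[OF bL]
               bounded_linear.has_vector_derivative[OF bN])
        then have "(r has_vector_derivative 0) (at u)"
          by (simp add: Lsimps Nsimps N(4))
        from bounded_bilinear.has_vector_derivative[OF bounded_bilinear_inner this this]
        show "\<exists>D\<le>0. ((\<lambda>s. r s \<bullet> r s) has_real_derivative D) (at u)"
          by (auto simp: has_real_derivative_iff_has_vector_derivative)
      qed
      also have "r 0 = 0" using y0 by (auto simp: r_def N(4))
      finally have "r s = 0" by (metis inner_eq_zero_iff inner_ge_zero inner_zero_left order_antisym)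
      then show ?thesis by (simp add: r_def)
    qed
    define X where "X s = (e s, N (y s) - P (e s))" for s
    have Xt: "norm (X t) \<le> C * norm (X 0) * exp (- a * t)"
    proof (rule decays[rule_format]; (intro conjI allI impI)?; (elim conjE)?)
      show "\<Delta> \<in> {0<..<\<Delta>star}" "t \<ge> 0" using \<Delta> \<open>t \<ge> 0\<close> by auto
      show "continuous_on {0..} X"
        unfolding X_def
        by (intro continuous_intros ce cy bounded_linear.continuous_on[OF bN] bounded_linear.continuous_on[OF bP])
      show "X s \<in> U" for s
      proof -
        obtain u where "N (y s) = L u" using N(2) by blast
        moreover obtain u' where "P (e s) = L u'" using N(2) by (auto simp: P_def)
        ultimately have "N (y s) - P (e s) = L (u - u')" by (simp add: Lsimps)
        then show ?thesis by (auto simp: U_def X_def)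
      qed
      fix k :: nat and u assume u: "real k * \<Delta> < u" "u < real (Suc k) * \<Delta>"
      define w where "w = real k * \<Delta>"
      have "w \<ge> 0" using \<Delta> by (simp add: w_def)
      then have "u \<ge> 0" using u by (simp add: w_def)
      have "((\<lambda>s. N (y s) - P (e s)) has_vector_derivative
         N (- L (y w + g (e w))) - P (- L (e w) - y u - g (e u))) (at u)"
        unfolding w_def
        by (intro has_vector_derivative_diff bounded_linear.has_vector_derivative[OF bN dy[OF u]]
             bounded_linear.has_vector_derivative[OF bP de[OF u]])
      from has_vector_derivative_Pair[OF de[OF u] this]
      have "(X has_vector_derivative (- L (e w) - y u - g (e u),
          N (- L (y w + g (e w))) - P (- L (e w) - y u - g (e u)))) (at u)"
        by (simp add: X_def[abs_def] w_def)
      \<comment> \<open>Here y = L (N y) = L q + L e and P y = y, with q the second component of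
        \<open>X\<close>. The difference of \<open>y\<close> between current and sampled time
        therefore supplies the difference of q, and replaces the sampled L e in q' by the current
        one.\<close>
      moreover have "(- L (e w) - y u - g (e u),
          N (- L (y w + g (e w))) - P (- L (e w) - y u - g (e u))) = F (X u) (X w)"
      proof -
        have Py: "P (y s) = y s" if "s \<ge> 0" for s
          using PL[of "N (y s)"] LNy[OF that] by simp
        show ?thesis
          using LNy[OF \<open>w \<ge> 0\<close>] LNy[OF \<open>u \<ge> 0\<close>] Py[OF \<open>w \<ge> 0\<close>] Py[OF \<open>u \<ge> 0\<close>]
          by (simp add: F_def X_def Lsimps Psimps Nsimps LP PL P_def[symmetric])
      qed
      ultimately show "(X has_vector_derivative F (X u) (X (real k * \<Delta>))) (at u)"
        by (simp add: w_def)
    qed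
    have X0: "norm (X 0) \<le> (1 + \<nu> + \<pi>) * (norm (e 0) + norm (y 0))"
    proof -
      have "norm (X 0) \<le> norm (e 0) + norm (N (y 0) - P (e 0))"
        unfolding X_def by (rule norm_Pair_le)
      also have "\<dots> \<le> norm (e 0) + (\<nu> * norm (y 0) + \<pi> * norm (e 0))"
        by (intro add_left_mono order_trans[OF norm_triangle_ineq4] add_mono \<nu> \<pi>)
      also have "\<dots> \<le> (1 + \<nu> + \<pi>) * (norm (e 0) + norm (y 0))"
        using \<nu>(1) \<pi>(1) by (simp add: algebra_simps)
      finally show ?thesis .
    qed
    have "norm (e t) \<le> norm (X t)" by (simp add: X_def norm_fst_le)
    also note Xt
    also have "C * norm (X 0) * exp (- a * t) \<le> C' * (norm (e 0) + norm (y 0)) * exp (- a * t)"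
      using mult_left_mono[OF X0, of C] decay(2)
      by (intro mult_right_mono) (auto simp: C'_def mult.assoc)
    finally show "norm (e t) \<le> C' * (norm (e 0) + norm (y 0)) * exp (- a * t)" .
  qed
  show ?thesis
    by (rule exI[of _ \<Delta>star], rule conjI[OF decay(1)], rule exI[of _ C'], rule conjI[OF \<open>C' > 0\<close>],
        rule exI[of _ a], rule conjI[OF decay(3) main])
qed

section \<open>Graph Laplacians and gradients\<close>

text \<open>This is the Kronecker product of the graph Laplacian with the identity on the blocks.
  Summing over all vertices keeps the edge set out of the algebra; the weights vanish off the
  edges.\<close>

definition laplacian :: "real^'n^'n \<Rightarrow> 'a::real_vector^'n \<Rightarrow> 'a^'n::finite" where
  "laplacian W v = (\<chi> i. \<Sum>j\<in>UNIV. W $ i $ j *\<^sub>R (v $ i - v $ j))"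

lemma linear_laplacian: "linear (laplacian W :: 'a::real_vector^'n \<Rightarrow> _)"
proof (rule linearI)
  fix u v :: "'a::real_vector^'n"
  show "laplacian W (u + v) = laplacian W u + laplacian W v"
    by (simp add: laplacian_def vec_eq_iff sum.distrib sum_subtractf algebra_simps)
qed (simp add: laplacian_def vec_eq_iff scaleR_sum_right mult.commute flip: scaleR_diff_right)

lemma laplacian_nth_neighbors:
  assumes "weighted_adjacency E W"
  shows "laplacian W v $ i = (\<Sum>j\<in>neighbors E i. W $ i $ j *\<^sub>R (v $ i - v $ j))"
  unfolding laplacian_def vec_lambda_beta
  by (rule sum.mono_neutral_right) (use assms in \<open>auto simp: weighted_adjacency_def neighbors_def\<close>)

text \<open>Exchanging the two summation indices and averaging, with \<open>W\<close> symmetric,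
  gives the Dirichlet form. Selfadjointness, nonnegativity and the description of the kernel are all
  read off from it.\<close>

lemma inner_laplacian:
  fixes u v :: "('a::real_inner)^'n"
  assumes "transpose W = W"
  shows "u \<bullet> laplacian W v =
    (\<Sum>i\<in>UNIV. \<Sum>j\<in>UNIV. W $ i $ j * ((u $ i - u $ j) \<bullet> (v $ i - v $ j))) / 2"
proof -
  have W: "W $ i $ j = W $ j $ i" for i j
    using arg_cong[OF assms, of "\<lambda>A. A $ j $ i"] by (simp add: Finite_Cartesian_Product.transpose_def)
  define T where "T i j = W $ i $ j * (u $ i \<bullet> (v $ i - v $ j))" for i j
  have "u \<bullet> laplacian W v = (\<Sum>i\<in>UNIV. \<Sum>j\<in>UNIV. T i j)"
    by (simp add: inner_vec_def laplacian_def inner_sum_right T_def)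
  moreover have "(\<Sum>i\<in>UNIV. \<Sum>j\<in>UNIV. T i j) = (\<Sum>i\<in>UNIV. \<Sum>j\<in>UNIV. T j i)"
    by (rule sum.swap)
  moreover have "T i j + T j i = W $ i $ j * ((u $ i - u $ j) \<bullet> (v $ i - v $ j))" for i j
    by (simp add: T_def W[of j i] algebra_simps inner_diff_left inner_diff_right)
  then have "(\<Sum>i\<in>UNIV. \<Sum>j\<in>UNIV. W $ i $ j * ((u $ i - u $ j) \<bullet> (v $ i - v $ j)))
      = (\<Sum>i\<in>UNIV. \<Sum>j\<in>UNIV. T i j) + (\<Sum>i\<in>UNIV. \<Sum>j\<in>UNIV. T j i)"
    by (simp flip: sum.distrib)
  ultimately show ?thesis by simp
qed

lemma laplacian_selfadjoint:
  fixes u v :: "('a::real_inner)^'n"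
  assumes "transpose W = W"
  shows "laplacian W u \<bullet> v = u \<bullet> laplacian W v"
  by (simp add: inner_commute[of "laplacian W u"] inner_laplacian[OF assms] inner_commute)

lemma laplacian_nonneg:
  fixes v :: "('a::real_inner)^'n"
  assumes "weighted_adjacency E W"
  shows "v \<bullet> laplacian W v \<ge> 0"
proof -
  have "W $ i $ j \<ge> 0" for i j
    using assms unfolding weighted_adjacency_def by (metis less_eq_real_def)
  then show ?thesis
    using assms by (auto simp: inner_laplacian weighted_adjacency_def intro!: sum_nonneg divide_nonneg_pos)
qed

text \<open>The Dirichlet energy of \<open>v\<close> vanishes and has nonnegative terms, so each
  term vanishes. Positive weights force equality across every edge, and connectedness propagates it
  along paths.\<close>

lemma laplacian_eq_0_imp_consensus:
  fixes v :: "('a::real_inner)^'n"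
  assumes W: "weighted_adjacency E W" and "connected_graph E" and v: "laplacian W v = 0"
  shows "v $ i = v $ j"
proof -
  have nonneg: "W $ i $ j * ((v $ i - v $ j) \<bullet> (v $ i - v $ j)) \<ge> 0" for i j
    using W unfolding weighted_adjacency_def by (metis inner_ge_zero less_eq_real_def mult_nonneg_nonneg)
  have "(\<Sum>i\<in>UNIV. \<Sum>j\<in>UNIV. W $ i $ j * ((v $ i - v $ j) \<bullet> (v $ i - v $ j))) = 0"
    using inner_laplacian[of W v v] W v by (simp add: weighted_adjacency_def)
  then have zero: "W $ i $ j * ((v $ i - v $ j) \<bullet> (v $ i - v $ j)) = 0" for i j
    using nonneg by (simp add: sum_nonneg_eq_0_iff sum_nonneg)
  have edge: "v $ i = v $ j" if "(i, j) \<in> E" for i j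
  proof -
    have "W $ i $ j \<noteq> 0"
      using W that unfolding weighted_adjacency_def by (metis less_irrefl)
    then show ?thesis using zero[of i j] by simp
  qed
  have "(i, j) \<in> E\<^sup>*" using assms(2) by (simp add: connected_graph_def)
  then show ?thesis by (induction rule: rtrancl_induct) (auto dest: edge)
qed

text \<open>The range of a selfadjoint map is the orthogonal complement of its kernel. Here the
  kernel contains only consensus vectors, to which every zero-sum vector is orthogonal.\<close>

lemma zero_sum_imp_in_range_laplacian:
  fixes v :: "('a::euclidean_space)^'n"
  assumes W: "weighted_adjacency E W" and conn: "connected_graph E" and v: "(\<Sum>i\<in>UNIV. v $ i) = 0"
  shows "v \<in> range (laplacian W)"
proof -
  let ?L = "laplacian W :: 'a^'n \<Rightarrow> 'a^'n"
  have "transpose W = W" using W by (simp add: weighted_adjacency_def)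
  then have adj: "adjoint ?L = ?L"
    by (intro adjoint_unique) (simp add: laplacian_selfadjoint)
  have "orthogonal u v" if u: "?L u = 0" for u
  proof -
    obtain c where "\<And>i. u $ i = c"
      using laplacian_eq_0_imp_consensus[OF W conn u] by metis
    then have "u \<bullet> v = c \<bullet> (\<Sum>i\<in>UNIV. v $ i)"
      by (simp add: inner_vec_def inner_sum_right)
    then show ?thesis by (simp add: v orthogonal_def)
  qed
  then have "v \<in> (?L -` {0})\<^sup>\<bottom>"
    by (auto simp: orthogonal_comp_def)
  also have "?L -` {0} = (range ?L)\<^sup>\<bottom>"
    using ker_orthogonal_comp_adjoint[of ?L] linear_laplacian adj by metis
  also have "(range ?L)\<^sup>\<bottom>\<^sup>\<bottom> = range ?L"
    by (intro orthogonal_comp_self linear_subspace_image linear_laplacian) simp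
  finally show ?thesis .
qed

section \<open>Gradients, strong monotonicity and stationarity\<close>

text \<open>The derivative is a linear functional, represented by the vector
  \<open>adjoint D 1\<close>; uniqueness of derivatives makes the description in \<open>grad\<close>
  well defined.\<close>

lemma GDERIV_grad:
  assumes "f differentiable (at x)"
  shows "GDERIV f x :> grad f x"
proof -
  obtain D where D: "(f has_derivative D) (at x)"
    using assms by (auto simp: differentiable_def)
  then have "linear D" by (rule has_derivative_linear)
  have "D = (\<lambda>h. h \<bullet> adjoint D 1)"
    using adjoint_works[OF \<open>linear D\<close>, of _ 1] by auto
  with D have "GDERIV f x :> adjoint D 1" by (simp add: gderiv_def)
  moreover have "d = adjoint D 1" if "GDERIV f x :> d" for d
  proof -
    have "(\<lambda>h. h \<bullet> d) = (\<lambda>h. h \<bullet> adjoint D 1)"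
      using that \<open>GDERIV f x :> adjoint D 1\<close> unfolding gderiv_def by (rule has_derivative_unique)
    then show ?thesis by (metis vector_eq_ldot)
  qed
  ultimately show ?thesis unfolding grad_def by (rule theI)
qed

text \<open>Strong convexity on the segment from \<open>y\<close> to \<open>x\<close> bounds the
  difference quotient at \<open>y\<close>. The parameter \<open>s\<close> lies in [0,1], so the
  limit is taken from the right.\<close>

lemma strongly_convex_grad_bound:
  fixes f :: "'a::euclidean_space \<Rightarrow> real"
  assumes f: "strongly_convex \<alpha> f" and "f differentiable (at y)"
  shows "(x - y) \<bullet> grad f y \<le> f x - f y - \<alpha> / 2 * (norm (x - y))\<^sup>2"
proof -
  define \<phi> where "\<phi> s = f (y + s *\<^sub>R (x - y))" for s
  have f': "(f has_derivative (\<lambda>h. h \<bullet> grad f y)) (at (y + 0 *\<^sub>R (x - y)))"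
    using GDERIV_grad[OF assms(2)] by (simp add: gderiv_def)
  have line': "((\<lambda>s. y + s *\<^sub>R (x - y)) has_derivative (\<lambda>s. s *\<^sub>R (x - y))) (at 0)"
    by (auto intro!: derivative_eq_intros)
  have "(\<phi> has_derivative (\<lambda>s. (s *\<^sub>R (x - y)) \<bullet> grad f y)) (at 0)"
    unfolding \<phi>_def by (rule has_derivative_compose[OF line' f'])
  then have "(\<phi> has_real_derivative (x - y) \<bullet> grad f y) (at 0)"
    by (simp add: has_field_derivative_def mult_commute_abs)
  then have "((\<lambda>s. (\<phi> s - \<phi> 0) / s) \<longlongrightarrow> (x - y) \<bullet> grad f y) (at_right 0)"
    by (auto simp: has_field_derivative_iff intro: tendsto_within_subset)
  moreover have "((\<lambda>s. f x - f y - \<alpha> / 2 * (1 - s) * (norm (x - y))\<^sup>2) \<longlongrightarrow>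
      f x - f y - \<alpha> / 2 * (1 - 0) * (norm (x - y))\<^sup>2) (at_right 0)"
    by (intro tendsto_intros)
  moreover have "\<forall>\<^sub>F s in at_right 0. (\<phi> s - \<phi> 0) / s \<le> f x - f y - \<alpha> / 2 * (1 - s) * (norm (x - y))\<^sup>2"
  proof -
    have "(\<phi> s - \<phi> 0) / s \<le> f x - f y - \<alpha> / 2 * (1 - s) * (norm (x - y))\<^sup>2" if "0 < s" "s < 1" for s
    proof -
      have "f (s *\<^sub>R x + (1 - s) *\<^sub>R y) \<le> s * f x + (1 - s) * f y - \<alpha> / 2 * s * (1 - s) * (norm (x - y))\<^sup>2"
        using f that by (auto simp: strongly_convex_def)
      moreover have "s *\<^sub>R x + (1 - s) *\<^sub>R y = y + s *\<^sub>R (x - y)" by (simp add: algebra_simps)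
      ultimately have "\<phi> s - \<phi> 0 \<le> (f x - f y - \<alpha> / 2 * (1 - s) * (norm (x - y))\<^sup>2) * s"
        by (simp add: \<phi>_def algebra_simps)
      then show ?thesis using that by (simp add: pos_divide_le_eq)
    qed
    then show ?thesis by (auto simp: eventually_at_right[of 0 1] intro!: exI[of _ 1])
  qed
  ultimately show ?thesis
    using tendsto_le[OF trivial_limit_at_right_real] by fastforce
qed

text \<open>Adding the first-order bounds at \<open>x\<close> and at \<open>y\<close> cancels the
  function values and doubles the factor \<open>\<alpha> / 2\<close>.\<close>

lemma strongly_convex_imp_grad_strongly_monotone:
  fixes f :: "'a::euclidean_space \<Rightarrow> real"
  assumes "strongly_convex \<alpha> f" and "\<And>u. f differentiable (at u)"
  shows "(x - y) \<bullet> (grad f x - grad f y) \<ge> \<alpha> * (norm (x - y))\<^sup>2"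
proof -
  have "(y - x) \<bullet> grad f x = - ((x - y) \<bullet> grad f x)"
    by (simp add: inner_diff_left)
  then show ?thesis
    using strongly_convex_grad_bound[OF assms, of x y] strongly_convex_grad_bound[OF assms, of y x]
    by (simp add: inner_diff_right norm_minus_commute)
qed

text \<open>Stationarity is what keeps the shifted tracker \<open>z + G c\<close> zero-sum at the
  initial time.\<close>

lemma sum_grad_eq_0_at_minimum:
  assumes "\<And>i. i \<in> I \<Longrightarrow> f i differentiable (at x)" and "is_arg_min (\<lambda>u. \<Sum>i\<in>I. f i u) (\<lambda>u. True) x"
  shows "(\<Sum>i\<in>I. grad (f i) x) = 0"
proof -
  have "((\<lambda>u. \<Sum>i\<in>I. f i u) has_derivative (\<lambda>h. \<Sum>i\<in>I. h \<bullet> grad (f i) x)) (at x)"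
    using GDERIV_grad[OF assms(1)] by (intro has_derivative_sum) (simp add: gderiv_def)
  then have "(\<lambda>h. \<Sum>i\<in>I. h \<bullet> grad (f i) x) = (\<lambda>h. 0)"
    by (rule differential_zero_maxmin[where S = UNIV, rotated 2])
       (use assms(2) in \<open>auto simp: is_arg_min_linorder\<close>)
  then have "h \<bullet> (\<Sum>i\<in>I. grad (f i) x) = 0" for h
    by (metis inner_sum_right)
  then show ?thesis by (metis inner_eq_zero_iff)
qed

lemma has_vector_derivative_vecI:
  fixes f :: "real \<Rightarrow> ('a::euclidean_space)^'n"
  assumes "\<And>i. ((\<lambda>s. f s $ i) has_vector_derivative D $ i) (at t)"
  shows "(f has_vector_derivative D) (at t)"
  unfolding has_vector_derivative_def
proof (subst has_derivative_componentwise_within, rule ballI)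
  fix b :: "'a^'n" assume "b \<in> Basis"
  then obtain i u where "b = axis i u" by (auto simp: Basis_vec_def)
  then show "((\<lambda>s. f s \<bullet> b) has_derivative (\<lambda>h. (h *\<^sub>R D) \<bullet> b)) (at t)"
    using has_derivative_inner_left[OF assms[of i, unfolded has_vector_derivative_def], of u]
    by (simp add: inner_axis)
qed

section \<open>Convergence of the algorithm\<close>

theorem mainTheorem2:
  fixes f :: "'n::finite \<Rightarrow> real^'d \<Rightarrow> real"
    and E :: "('n \<times> 'n) set"
    and W :: "real^'n^'n"
    and \<alpha> \<beta> :: real
    and xstar :: "real^'d"
    and x0 z0 :: "(real^'d)^'n"
  assumes "refl E"
    and "weighted_adjacency E W"
    and "\<alpha> > 0"
    and "\<And>i u. f i differentiable (at u)"
    and "\<And>i. strongly_convex \<alpha> (f i)"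
    and "\<beta> > 0"
    and "\<And>i. \<beta>-lipschitz_on UNIV (grad (f i))"
    and "sym E"
    and "connected_graph E"
    and "is_arg_min (\<lambda>u. \<Sum>i\<in>UNIV. f i u) (\<lambda>u. True) xstar"
    and "(\<Sum>i\<in>UNIV. z0 $ i) = 0"
  shows "\<exists>\<Delta>star>0. \<exists>a3>0. \<exists>a4>0. \<forall>\<Delta>\<in>{0<..<\<Delta>star}. \<forall>x z.
           STGT_solution E W f \<Delta> x z \<and> x 0 = x0 \<and> z 0 = z0 \<longrightarrow>
             (\<forall>t\<ge>0. \<forall>i. norm (x t $ i - xstar) \<le> a3 * exp (- a4 * t))"
proof -
  \<comment> \<open>The equilibrium is x = c, z = - G c; \<open>g\<close> is the stacked gradient
    recentred there, so that it vanishes at zero error.\<close>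
  define c :: "(real^'d)^'n" where "c = (\<chi> i. xstar)"
  define G :: "(real^'d)^'n \<Rightarrow> (real^'d)^'n" where "G v = (\<chi> i. grad (f i) (v $ i))" for v
  define g where "g v = G (v + c) - G c" for v
  let ?L = "laplacian W :: (real^'d)^'n \<Rightarrow> _"
  have W: "transpose W = W" using assms(2) by (simp add: weighted_adjacency_def)
  have g_mono: "v \<bullet> g v \<ge> \<alpha> * (norm v)\<^sup>2" for v
  proof -
    have "\<alpha> * (norm (v $ i))\<^sup>2 \<le> v $ i \<bullet> g v $ i" for i
      using strongly_convex_imp_grad_strongly_monotone[OF assms(5,4), of "v $ i + xstar" xstar]
      by (simp add: g_def G_def c_def)
    then have "(\<Sum>i\<in>UNIV. \<alpha> * (norm (v $ i))\<^sup>2) \<le> (\<Sum>i\<in>UNIV. v $ i \<bullet> g v $ i)"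
      by (rule sum_mono)
    then show ?thesis
      by (simp add: power2_norm_eq_inner inner_vec_def sum_distrib_left)
  qed
  have g_lip: "norm (g v - g w) \<le> \<beta> * norm (v - w)" for v w
  proof (rule power2_le_imp_le)
    have "norm (g v $ i - g w $ i) \<le> \<beta> * norm (v $ i - w $ i)" for i
      using lipschitz_onD[OF assms(7), of "v $ i + xstar" "w $ i + xstar" i]
      by (simp add: g_def G_def c_def dist_norm)
    then have "(\<Sum>i\<in>UNIV. (norm (g v $ i - g w $ i))\<^sup>2) \<le> (\<Sum>i\<in>UNIV. (\<beta> * norm (v $ i - w $ i))\<^sup>2)"
      by (intro sum_mono power_mono) auto
    then show "(norm (g v - g w))\<^sup>2 \<le> (\<beta> * norm (v - w))\<^sup>2"
      by (simp add: power2_norm_eq_inner inner_vec_def sum_distrib_left power_mult_distrib)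
  qed (use assms(6) in simp)
  have g0: "g 0 = 0" by (simp add: g_def)
  obtain \<Delta>star C a where pos: "\<Delta>star > 0" "C > 0" "a > 0" and
    decay: "\<forall>\<Delta>\<in>{0<..<\<Delta>star}. \<forall>e y.
           continuous_on {0..} e \<and> continuous_on {0..} y \<and> y 0 \<in> range ?L \<and>
           (\<forall>(k::nat) t. real k * \<Delta> < t \<and> t < real (Suc k) * \<Delta> \<longrightarrow>
              (e has_vector_derivative - ?L (e (real k * \<Delta>)) - y t - g (e t)) (at t) \<and>
              (y has_vector_derivative - ?L (y (real k * \<Delta>) + g (e (real k * \<Delta>)))) (at t)) \<longrightarrow>
           (\<forall>t\<ge>0. norm (e t) \<le> C * (norm (e 0) + norm (y 0)) * exp (- a * t))"
    using tracking_decay[OF linear_laplacian laplacian_selfadjoint[OF W] laplacian_nonneg[OF assms(2)]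
        assms(3) g_mono assms(6) g_lip g0]
    by (elim exE conjE) assumption
  \<comment> \<open>The summand 1 keeps \<open>a3\<close> positive even when both initial errors
    vanish.\<close>
  define a3 where "a3 = C * (norm (x0 - c) + norm (z0 + G c)) + 1"
  have "a3 > 0" using pos(2) by (simp add: a3_def add_nonneg_pos)
  have main: "\<forall>\<Delta>\<in>{0<..<\<Delta>star}. \<forall>x z.
      STGT_solution E W f \<Delta> x z \<and> x 0 = x0 \<and> z 0 = z0 \<longrightarrow>
      (\<forall>t\<ge>0. \<forall>i. norm (x t $ i - xstar) \<le> a3 * exp (- a * t))"
  proof (intro ballI allI impI, elim conjE)
    fix \<Delta> x z and t :: real and i
    assume \<Delta>: "\<Delta> \<in> {0<..<\<Delta>star}" and sol: "STGT_solution E W f \<Delta> x z" and "x 0 = x0" "z 0 = z0"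
      and "t \<ge> 0"
    define e where "e s = x s - c" for s
    define y where "y s = z s + G c" for s
    have cont: "continuous_on {0..} e" "continuous_on {0..} y"
      using sol unfolding e_def y_def STGT_solution_def by (auto intro!: continuous_intros)
    have "(\<Sum>i\<in>UNIV. grad (f i) xstar) = 0"
      using assms(4,10) by (intro sum_grad_eq_0_at_minimum) auto
    then have "(\<Sum>i\<in>UNIV. y 0 $ i) = 0"
      using assms(11) \<open>z 0 = z0\<close> by (simp add: y_def G_def c_def sum.distrib)
    then have y0: "y 0 \<in> range ?L"
      by (rule zero_sum_imp_in_range_laplacian[OF assms(2,9)])
    have ode: "(e has_vector_derivative - ?L (e (real k * \<Delta>)) - y s - g (e s)) (at s) \<and>
        (y has_vector_derivative - ?L (y (real k * \<Delta>) + g (e (real k * \<Delta>)))) (at s)"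
      if s: "real k * \<Delta> < s \<and> s < real (Suc k) * \<Delta>" for k :: nat and s
    proof -
      define w where "w = real k * \<Delta>"
      \<comment> \<open>Strictly inside a sampling interval the one-interval derivative of the
        solution concept is the ordinary two-sided one.\<close>
      have at: "at s within {real k * \<Delta>..<real (Suc k) * \<Delta>} = at s"
        by (rule at_within_open_subset[of _ "{real k * \<Delta><..<real (Suc k) * \<Delta>}"]) (use s in auto)
      have s_in: "s \<in> {real k * \<Delta>..<real (Suc k) * \<Delta>}" using s by simp
      note sol_s = sol[unfolded STGT_solution_def, THEN conjunct2, THEN conjunct2, rule_format,
          OF s_in, unfolded at, folded w_def]
      have "((\<lambda>s. e s $ i) has_vector_derivative (- ?L (e w) - y s - g (e s)) $ i) (at s)" for i
      proof -
        \<comment> \<open>The consensus shift \<open>c\<close> drops out of the differences and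
          \<open>G c\<close> cancels between \<open>y\<close> and \<open>g\<close>. The trailing
          zero stands for the derivative of the constant shift.\<close>
        have rhs: "(- ?L (e w) - y s - g (e s)) $ i =
            (- (\<Sum>j\<in>neighbors E i. (W $ i $ j) *\<^sub>R (x w $ i - x w $ j))
             - z s $ i - grad (f i) (x s $ i)) - 0"
          by (simp add: laplacian_nth_neighbors[OF assms(2)] e_def y_def g_def G_def c_def)
        have e_i: "(\<lambda>s. e s $ i) = (\<lambda>s. x s $ i - xstar)"
          by (simp add: e_def c_def)
        show ?thesis
          unfolding rhs e_i
          by (rule has_vector_derivative_diff[OF sol_s[THEN conjunct1] has_vector_derivative_const])
      qed
      moreover have "((\<lambda>s. y s $ i) has_vector_derivative (- ?L (y w + g (e w))) $ i) (at s)" for i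
      proof -
        have rhs: "(- ?L (y w + g (e w))) $ i =
            (- (\<Sum>j\<in>neighbors E i. (W $ i $ j) *\<^sub>R (z w $ i - z w $ j))
             - (\<Sum>j\<in>neighbors E i. (W $ i $ j) *\<^sub>R
                  (grad (f i) (x w $ i) - grad (f j) (x w $ j)))) + 0"
        proof -
          have "y w + g (e w) = z w + G (x w)" by (simp add: y_def g_def e_def)
          then show ?thesis
            by (simp add: linear_add[OF linear_laplacian] laplacian_nth_neighbors[OF assms(2)] G_def)
        qed
        have y_i: "(\<lambda>s. y s $ i) = (\<lambda>s. z s $ i + grad (f i) xstar)"
          by (simp add: y_def G_def c_def)
        show ?thesis
          unfolding rhs y_i
          by (rule has_vector_derivative_add[OF sol_s[THEN conjunct2] has_vector_derivative_const])
      qed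
      ultimately show ?thesis
        unfolding w_def by (rule conjI[OF has_vector_derivative_vecI has_vector_derivative_vecI])
    qed
    have e_decay: "\<forall>t\<ge>0. norm (e t) \<le> C * (norm (e 0) + norm (y 0)) * exp (- a * t)"
    proof (rule mp[OF bspec[OF decay \<Delta>, THEN spec[of _ e], THEN spec[of _ y]]])
      show "continuous_on {0..} e \<and> continuous_on {0..} y \<and> y 0 \<in> range ?L \<and>
           (\<forall>(k::nat) t. real k * \<Delta> < t \<and> t < real (Suc k) * \<Delta> \<longrightarrow>
              (e has_vector_derivative - ?L (e (real k * \<Delta>)) - y t - g (e t)) (at t) \<and>
              (y has_vector_derivative - ?L (y (real k * \<Delta>) + g (e (real k * \<Delta>)))) (at t))"
        by (rule conjI[OF cont(1) conjI[OF cont(2) conjI[OF y0]]]) (intro allI impI, rule ode)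
    qed
    have "norm (x t $ i - xstar) \<le> norm (e t)"
      using Finite_Cartesian_Product.norm_nth_le[of "e t" i] by (simp add: e_def c_def)
    also have "\<dots> \<le> C * (norm (e 0) + norm (y 0)) * exp (- a * t)"
      by (rule e_decay[rule_format, OF \<open>t \<ge> 0\<close>])
    also have "\<dots> \<le> a3 * exp (- a * t)"
      using \<open>x 0 = x0\<close> \<open>z 0 = z0\<close> by (intro mult_right_mono) (auto simp: e_def y_def a3_def)
    finally show "norm (x t $ i - xstar) \<le> a3 * exp (- a * t)" .
  qed
  show ?thesis
    by (rule exI[of _ \<Delta>star], rule conjI[OF pos(1)], rule exI[of _ a3], rule conjI[OF \<open>a3 > 0\<close>],
        rule exI[of _ a], rule conjI[OF pos(3) main])
qed

end
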